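(* For every graph $G$, $T(G) \le \min\{\chi'(G), \chi(K(G))\}$.
   Context: A clique is a set of vertices inducing a complete subgraph. A tessellation $\mathcal{T}$ of a graph $G$ is a partition of $V(G)$ into cliques; an edge belongs to $\mathcal{T}$ iff both endpoints lie in the same clique of $\mathcal{T}$, and $\mathcal{E}(\mathcal{T})$ denotes the set of edges belonging to $\mathcal{T}$. A tessellation cover of size $t$ of $G$ is a set of $t$ tessellations $\mathcal{T}_1,\dots,\mathcal{T}_t$ with $\bigcup_i \mathcal{E}(\mathcal{T}_i)=E(G)$. The tessellation cover number $T(G)$ is the minimum size of a tessellation cover of $G$. $\chi'(G)$ is the chromatic index of $G$, and $K(G)$ is the clique graph of $G$ (the intersection graph of the maximal cliques of $G$), with $\chi(K(G))$ its chromatic number. *)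

theory Defs
  imports Main "HOL-Library.Ramsey" "HOL-Library.Disjoint_Sets"
begin

text \<open>Edges are two-element vertex sets; the vertex set may be empty.\<close>

definition fin_simple_graph :: "'a set \<Rightarrow> 'a set set \<Rightarrow> bool" where
  "fin_simple_graph V E \<longleftrightarrow> finite V \<and> E \<subseteq> [V]\<^bsup>2\<^esup>"

definition graph_clique :: "'a set \<Rightarrow> 'a set set \<Rightarrow> 'a set \<Rightarrow> bool" where
  "graph_clique V E C \<longleftrightarrow> C \<subseteq> V \<and> clique C E"

definition tessellation :: "'a set \<Rightarrow> 'a set set \<Rightarrow> 'a set set \<Rightarrow> bool" where
  "tessellation V E T \<longleftrightarrow> partition_on V T \<and> (\<forall>C\<in>T. graph_clique V E C)"

definition tessellation_edges :: "'a set set \<Rightarrow> 'a set set \<Rightarrow> 'a set set" where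
  "tessellation_edges E T = {e \<in> E. \<exists>C\<in>T. e \<subseteq> C}"

definition tessellation_cover :: "'a set \<Rightarrow> 'a set set \<Rightarrow> nat \<Rightarrow> 'a set set set \<Rightarrow> bool" where
  "tessellation_cover V E t \<T> \<longleftrightarrow>
     finite \<T> \<and> card \<T> = t \<and> (\<forall>T\<in>\<T>. tessellation V E T) \<and>
     (\<Union>T\<in>\<T>. tessellation_edges E T) = E"

text \<open>
  The minima below are taken with \<^const>\<open>Least\<close>; the existence lemmas at the end show that for
  finite graphs they range over nonempty sets. An edgeless graph has the empty cover.
\<close>

definition tessellation_cover_number :: "'a set \<Rightarrow> 'a set set \<Rightarrow> nat" where
  "tessellation_cover_number V E = (LEAST t. \<exists>\<T>. tessellation_cover V E t \<T>)"

definition vertex_coloring :: "'a set \<Rightarrow> 'a set set \<Rightarrow> nat \<Rightarrow> ('a \<Rightarrow> nat) \<Rightarrow> bool" where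
  "vertex_coloring V E k f \<longleftrightarrow>
     f ` V \<subseteq> {..<k} \<and> (\<forall>u\<in>V. \<forall>v\<in>V. {u, v} \<in> E \<longrightarrow> f u \<noteq> f v)"

definition chromatic_number :: "'a set \<Rightarrow> 'a set set \<Rightarrow> nat" where
  "chromatic_number V E = (LEAST k. \<exists>f. vertex_coloring V E k f)"

definition edge_coloring :: "'a set set \<Rightarrow> nat \<Rightarrow> ('a set \<Rightarrow> nat) \<Rightarrow> bool" where
  "edge_coloring E k f \<longleftrightarrow>
     f ` E \<subseteq> {..<k} \<and> (\<forall>d\<in>E. \<forall>e\<in>E. d \<noteq> e \<and> d \<inter> e \<noteq> {} \<longrightarrow> f d \<noteq> f e)"

definition chromatic_index :: "'a set set \<Rightarrow> nat" where
  "chromatic_index E = (LEAST k. \<exists>f. edge_coloring E k f)"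

definition maximal_cliques :: "'a set \<Rightarrow> 'a set set \<Rightarrow> 'a set set" where
  "maximal_cliques V E =
     {C. graph_clique V E C \<and> (\<forall>D. graph_clique V E D \<and> C \<subseteq> D \<longrightarrow> D = C)}"

text \<open>
  The clique graph of \<open>(V, E)\<close> is \<open>(maximal_cliques V E, clique_graph_edges V E)\<close>.
\<close>

definition clique_graph_edges :: "'a set \<Rightarrow> 'a set set \<Rightarrow> 'a set set set" where
  "clique_graph_edges V E =
     {{C, D} |C D. C \<in> maximal_cliques V E \<and> D \<in> maximal_cliques V E \<and> C \<noteq> D \<and> C \<inter> D \<noteq> {}}"

lemma ex_edge_coloring:
  assumes "fin_simple_graph V E"
  shows "\<exists>k f. edge_coloring E k f"
proof -
  have "finite E"
    using assms by (meson finite_imp_finite_nsets finite_subset fin_simple_graph_def)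
  then obtain f :: "'a set \<Rightarrow> nat" where "bij_betw f E {0..<card E}"
    using ex_bij_betw_finite_nat by blast
  then have "edge_coloring E (card E) f"
    unfolding edge_coloring_def bij_betw_def inj_on_def by auto
  then show ?thesis by blast
qed

lemma ex_vertex_coloring:
  assumes "fin_simple_graph V E"
  shows "\<exists>k f. vertex_coloring V E k f"
proof -
  obtain f :: "'a \<Rightarrow> nat" where f: "bij_betw f V {0..<card V}"
    using assms ex_bij_betw_finite_nat unfolding fin_simple_graph_def by blast
  have "u \<noteq> v" if "{u, v} \<in> E" for u v
    using assms that unfolding fin_simple_graph_def nsets_def by force
  with f have "vertex_coloring V E (card V) f"
    unfolding vertex_coloring_def bij_betw_def inj_on_def by auto
  then show ?thesis by blast
qed

lemma fin_simple_graph_clique_graph: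
  assumes "fin_simple_graph V E"
  shows "fin_simple_graph (maximal_cliques V E) (clique_graph_edges V E)"
proof -
  have "maximal_cliques V E \<subseteq> Pow V"
    unfolding maximal_cliques_def graph_clique_def by auto
  then have "finite (maximal_cliques V E)"
    using assms unfolding fin_simple_graph_def by (meson finite_Pow_iff finite_subset)
  then show ?thesis
    unfolding fin_simple_graph_def clique_graph_edges_def nsets_def by (auto simp: card_2_iff)
qed

lemma ex_tessellation_cover:
  assumes "fin_simple_graph V E"
  shows "\<exists>t \<T>. tessellation_cover V E t \<T>"
proof -
  define P where "P e = insert e ((\<lambda>v. {v}) ` (V - e))" for e
  have E: "e \<subseteq> V" "card e = 2" if "e \<in> E" for e
    using assms that unfolding fin_simple_graph_def nsets_def by auto
  have "finite E"
    using assms by (meson finite_imp_finite_nsets finite_subset fin_simple_graph_def)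
  moreover have "tessellation V E (P e)" if "e \<in> E" for e
  proof -
    have "e \<noteq> {}" using E(2)[OF that] by auto
    with E(1)[OF that] have "partition_on V (P e)"
      unfolding P_def partition_on_def disjoint_def by auto
    moreover have "clique e E"
      using E(2)[OF that] that unfolding clique_def card_2_iff by (auto simp: insert_commute)
    ultimately show ?thesis
      using E(1)[OF that] unfolding tessellation_def graph_clique_def P_def
      by (auto simp: clique_def)
  qed
  moreover have "e \<in> tessellation_edges E (P e)" if "e \<in> E" for e
    using that unfolding tessellation_edges_def P_def by auto
  moreover have "tessellation_edges E T \<subseteq> E" for T
    unfolding tessellation_edges_def by auto
  ultimately have "tessellation_cover V E (card (P ` E)) (P ` E)"
    unfolding tessellation_cover_def by blast
  then show ?thesis by blast
qed

end

theory Submission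
  imports Defs
begin

text \<open>
  Both bounds are instances of one construction. Let a family of nonempty cliques cover all edges,
  and colour it with \<open>k\<close> colours so that intersecting members get different colours. Each colour
  class is then disjoint, and adding singletons extends it to a tessellation. The edges themselves
  form such a family, and so do the maximal cliques.
\<close>

lemma partition_on_insert_singletons:
  assumes "disjoint F" "{} \<notin> F" "\<Union>F \<subseteq> V"
  shows "partition_on V (F \<union> (\<lambda>v. {v}) ` (V - \<Union>F))"
  using assms unfolding partition_on_def disjoint_def by auto

text \<open>Blocks of a partition are nonempty, so the empty set is kept out of \<open>F\<close>.
  Members of \<open>F\<close> may overlap; only those of equal colour must be disjoint.\<close>

lemma tessellation_cover_number_le_colored_cliques:
  assumes cliques: "\<And>C. C \<in> F \<Longrightarrow> graph_clique V E C \<and> C \<noteq> {}"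
    and cover: "\<And>e. e \<in> E \<Longrightarrow> \<exists>C\<in>F. e \<subseteq> C"
    and range: "\<And>C. C \<in> F \<Longrightarrow> f C < k"
    and proper: "\<And>C D. C \<in> F \<Longrightarrow> D \<in> F \<Longrightarrow> C \<noteq> D \<Longrightarrow> C \<inter> D \<noteq> {} \<Longrightarrow> f C \<noteq> f D"
  shows "tessellation_cover_number V E \<le> k"
proof -
  define F' where "F' i = {C \<in> F. f C = i}" for i :: nat
  define T where "T i = F' i \<union> (\<lambda>v. {v}) ` (V - \<Union>(F' i))" for i
  have "tessellation V E (T i)" for i
  proof -
    have "partition_on V (T i)"
      unfolding T_def
    proof (rule partition_on_insert_singletons)
      show "disjoint (F' i)"
        using proper unfolding F'_def disjoint_def by blast
      show "{} \<notin> F' i" "\<Union>(F' i) \<subseteq> V"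
        using cliques unfolding F'_def graph_clique_def by auto
    qed
    \<comment> \<open>An added singleton is a clique vacuously, having no two distinct
      vertices.\<close>
    moreover have "graph_clique V E C" if "C \<in> T i" for C
      using that cliques unfolding T_def F'_def by (auto simp: graph_clique_def clique_def)
    ultimately show ?thesis
      unfolding tessellation_def by blast
  qed
  moreover have "(\<Union>i<k. tessellation_edges E (T i)) = E"
  proof (intro equalityI subsetI)
    fix e assume "e \<in> E"
    with cover obtain C where "C \<in> F" "e \<subseteq> C" by blast
    \<comment> \<open>The colour of \<open>C\<close> picks out a tessellation with \<open>C\<close>
      as a block.\<close>
    with \<open>e \<in> E\<close> have "f C < k" "e \<in> tessellation_edges E (T (f C))"
      using range unfolding tessellation_edges_def T_def F'_def by auto
    then show "e \<in> (\<Union>i<k. tessellation_edges E (T i))" by blast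
  qed (auto simp: tessellation_edges_def)
  \<comment> \<open>Different colours can give the same tessellation, for instance when both classes
    are empty, so the cover may have fewer than \<open>k\<close> members.\<close>
  ultimately have "tessellation_cover V E (card (T ` {..<k})) (T ` {..<k})"
    unfolding tessellation_cover_def by auto
  then have "tessellation_cover_number V E \<le> card (T ` {..<k})"
    unfolding tessellation_cover_number_def by (blast intro: Least_le)
  also have "\<dots> \<le> k"
    using card_image_le[of "{..<k}" T] by simp
  finally show ?thesis .
qed

lemma graph_clique_edge:
  assumes "fin_simple_graph V E" "e \<in> E"
  shows "graph_clique V E e"
  using assms unfolding fin_simple_graph_def graph_clique_def clique_def nsets_def
  by (auto simp: card_2_iff insert_commute)

text \<open>A finite \<open>V\<close> has only finitely many cliques, so some inclusion-maximal one
  lies above \<open>C\<close>.\<close>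

lemma graph_clique_extends_to_maximal:
  assumes "finite V" "graph_clique V E C"
  obtains D where "D \<in> maximal_cliques V E" "C \<subseteq> D"
proof -
  have "{D. graph_clique V E D} \<subseteq> Pow V"
    unfolding graph_clique_def by blast
  then have "finite {D. graph_clique V E D}"
    using assms(1) by (meson finite_Pow_iff finite_subset)
  from finite_has_maximal2[OF this, of C] assms(2) that show thesis
    unfolding maximal_cliques_def by blast
qed

lemma tessellation_cover_number_le_chromatic_index:
  assumes G: "fin_simple_graph V E"
  shows "tessellation_cover_number V E \<le> chromatic_index E"
proof -
  have "\<exists>f. edge_coloring E (chromatic_index E) f"
    unfolding chromatic_index_def using ex_edge_coloring[OF G] by (rule LeastI_ex)
  then obtain f where f: "edge_coloring E (chromatic_index E) f" ..
  show ?thesis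
  \<comment> \<open>Members of \<open>E\<close> that meet are edges with a common endpoint, which is
    exactly where a proper edge colouring separates.\<close>
  proof (rule tessellation_cover_number_le_colored_cliques[where F = E and f = f])
    show "graph_clique V E e \<and> e \<noteq> {}" if "e \<in> E" for e
      using graph_clique_edge[OF G that] G that unfolding fin_simple_graph_def nsets_def by force
  qed (use f in \<open>auto simp: edge_coloring_def\<close>)
qed

lemma tessellation_cover_number_le_chromatic_clique_graph:
  assumes G: "fin_simple_graph V E"
  shows "tessellation_cover_number V E
           \<le> chromatic_number (maximal_cliques V E) (clique_graph_edges V E)"
    (is "_ \<le> ?k")
proof -
  have "\<exists>f. vertex_coloring (maximal_cliques V E) (clique_graph_edges V E) ?k f"
    unfolding chromatic_number_def
    using ex_vertex_coloring[OF fin_simple_graph_clique_graph[OF G]] by (rule LeastI_ex)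
  then obtain f where f: "vertex_coloring (maximal_cliques V E) (clique_graph_edges V E) ?k f" ..
  \<comment> \<open>The empty set is a maximal clique when \<open>V\<close> is empty.\<close>
  show ?thesis
  proof (rule tessellation_cover_number_le_colored_cliques
      [where F = "maximal_cliques V E - {{}}" and f = f])
    show "\<exists>C\<in>maximal_cliques V E - {{}}. e \<subseteq> C" if "e \<in> E" for e
    proof -
      have "finite V" "e \<noteq> {}"
        using G that unfolding fin_simple_graph_def nsets_def by force+
      \<comment> \<open>A clique containing the nonempty \<open>e\<close> is nonempty, so removing
        the empty set leaves every edge covered.\<close>
      then show ?thesis
        using graph_clique_extends_to_maximal[OF _ graph_clique_edge[OF G that]] by blast
    qed
    show "f C \<noteq> f D" if "C \<in> maximal_cliques V E - {{}}" "D \<in> maximal_cliques V E - {{}}"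
      "C \<noteq> D" "C \<inter> D \<noteq> {}" for C D
    proof -
      \<comment> \<open>Distinct maximal cliques that meet are adjacent in the clique graph, so
        \<open>f\<close> separates them.\<close>
      have "{C, D} \<in> clique_graph_edges V E"
        using that unfolding clique_graph_edges_def by blast
      with f that show ?thesis
        unfolding vertex_coloring_def by blast
    qed
  qed (use f in \<open>auto simp: vertex_coloring_def maximal_cliques_def\<close>)
qed

theorem theorem1:
  fixes V :: "'a set" and E :: "'a set set"
  assumes "fin_simple_graph V E"
  shows "tessellation_cover_number V E
           \<le> min (chromatic_index E)
                 (chromatic_number (maximal_cliques V E) (clique_graph_edges V E))"
  using tessellation_cover_number_le_chromatic_index[OF assms]
    tessellation_cover_number_le_chromatic_clique_graph[OF assms]
  by simp

end
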